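(* Let $R=K[x_{ij},y_j]$ be the polynomial ring, let $>$ be a monomial ordering on $R$, and let $I$ and $J$ be ideals in $R$. Let $m(I)$ and $m(J)$ denote the unique minimal (monomial) generating sets of the leading ideals $\mathrm{Lt}(I)$ and $\mathrm{Lt}(J)$ respectively. If $\mathrm{supp}(m(I))\cap \mathrm{supp}(m(J))=\emptyset$, i.e. if the set of variables occurring in the monomials of $m(I)$ is disjoint from the set of variables occurring in the monomials of $m(J)$, then $I\cap J=IJ$.
   Context: $K$ is a field, $n\ge 2$, and $R=K[x_{ij},y_j \mid 1\le i,j\le n]$ is the polynomial ring in the indeterminates $x_{ij}$, $y_j$. For a nonzero $f\in R$, $\mathrm{Lt}(f)$ is its leading term with respect to $>$, and $\mathrm{Lt}(I)$ is the monomial ideal generated by the leading terms of nonzero elements of $I$. For a set $T$ of monomials, $\mathrm{supp}(T)=\{(i,j,0)\mid x_{ij}\text{ divides some } m\in T\}\cup\{(0,0,k)\mid y_k\text{ divides some } m\in T\}$; that is, it records the variables dividing some monomial in $T$. *)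

theory Defs
  imports Complex_Main "HOL-Library.Poly_Mapping" "HOL-Library.Cardinality"
begin

(* The finite type 'n plays the role of the index set {1,...,n}, so n = CARD('n).
   A monomial is represented by its exponent vector; an element of R is a finitely
   supported function from exponent vectors to K, with the convolution product. *)

datatype 'n var = X 'n 'n | Y 'n

type_synonym 'n expo = "'n var \<Rightarrow>\<^sub>0 nat"
type_synonym ('n, 'k) R = "'n expo \<Rightarrow>\<^sub>0 'k"

abbreviation monom :: "'n expo \<Rightarrow> ('n, 'k::field) R" where
  "monom t \<equiv> Poly_Mapping.single t 1"

abbreviation indet :: "'n var \<Rightarrow> ('n, 'k::field) R" where
  "indet v \<equiv> monom (Poly_Mapping.single v 1)"

(* A commutative ring is a module over itself; its ideals are the submodules. *)

lemma module_self: "module ((*) :: 'a::comm_ring_1 \<Rightarrow> 'a \<Rightarrow> 'a)"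
  by unfold_locales (simp_all add: algebra_simps)

abbreviation is_ideal :: "'a::comm_ring_1 set \<Rightarrow> bool" where
  "is_ideal \<equiv> module.subspace (*)"

abbreviation ideal_gen :: "'a::comm_ring_1 set \<Rightarrow> 'a set" where
  "ideal_gen \<equiv> module.span (*)"

definition ideal_mult :: "'a::comm_ring_1 set \<Rightarrow> 'a set \<Rightarrow> 'a set" where
  "ideal_mult I J = ideal_gen {a * b | a b. a \<in> I \<and> b \<in> J}"

(* (s, t) \<in> ord means s \<le> t in the ordering. *)

definition monomial_ordering :: "'n expo rel \<Rightarrow> bool" where
  "monomial_ordering ord \<longleftrightarrow>
     well_order_on UNIV ord \<and> (\<forall>s t u. (s, t) \<in> ord \<longrightarrow> (s + u, t + u) \<in> ord)"

(* Unspecified for f = 0. *)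

definition lead_expo :: "'n expo rel \<Rightarrow> ('n, 'k::field) R \<Rightarrow> 'n expo" where
  "lead_expo ord f =
     (THE t. t \<in> Poly_Mapping.keys f \<and> (\<forall>s\<in>Poly_Mapping.keys f. (s, t) \<in> ord))"

definition Lt :: "'n expo rel \<Rightarrow> ('n, 'k::field) R \<Rightarrow> ('n, 'k) R" where
  "Lt ord f = Poly_Mapping.single (lead_expo ord f) (Poly_Mapping.lookup f (lead_expo ord f))"

definition Lt_ideal :: "'n expo rel \<Rightarrow> ('n, 'k::field) R set \<Rightarrow> ('n, 'k) R set" where
  "Lt_ideal ord I = ideal_gen {Lt ord f | f. f \<in> I \<and> f \<noteq> 0}"

definition minimal_monomial_gens :: "('n, 'k::field) R set \<Rightarrow> ('n, 'k) R set \<Rightarrow> bool" where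
  "minimal_monomial_gens L G \<longleftrightarrow>
     G \<subseteq> range monom \<and> ideal_gen G = L \<and> (\<forall>H. H \<subset> G \<longrightarrow> ideal_gen H \<noteq> L)"

definition min_gens :: "'n expo rel \<Rightarrow> ('n, 'k::field) R set \<Rightarrow> ('n, 'k) R set" where
  "min_gens ord I = (THE G. minimal_monomial_gens (Lt_ideal ord I) G)"

(* The variable X i j stands for the triple (i,j,0) and Y k for the triple (0,0,k). *)

definition supp :: "('n, 'k::field) R set \<Rightarrow> 'n var set" where
  "supp T = {X i j | i j. \<exists>m\<in>T. indet (X i j) dvd m} \<union> {Y k | k. \<exists>m\<in>T. indet (Y k) dvd m}"

(* The remaining lemmas show that the two definite descriptions above are well defined. *)

lemma lead_expo_ex1:
  fixes f :: "('n, 'k::field) R"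
  assumes ord: "monomial_ordering ord" and "f \<noteq> 0"
  shows "\<exists>!t. t \<in> Poly_Mapping.keys f \<and> (\<forall>s\<in>Poly_Mapping.keys f. (s, t) \<in> ord)"
proof -
  have lin: "refl ord" "trans ord" "antisym ord" "total ord"
    using ord by (auto simp: monomial_ordering_def order_on_defs)
  have "finite A \<Longrightarrow> A \<noteq> {} \<Longrightarrow> \<exists>t\<in>A. \<forall>s\<in>A. (s, t) \<in> ord" for A
  proof (induction A rule: finite_ne_induct)
    case (singleton x)
    then show ?case using lin(1) by (simp add: refl_onD)
  next
    case (insert x F)
    then obtain t where t: "t \<in> F" "\<forall>s\<in>F. (s, t) \<in> ord" by auto
    have "(x, t) \<in> ord \<or> (t, x) \<in> ord"
      using lin by (metis UNIV_I refl_onD total_on_def)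
    moreover have "(x, x) \<in> ord" using lin(1) by (simp add: refl_onD)
    ultimately show ?case using t lin(2) by (metis insert_iff transD)
  qed
  then have "\<exists>t\<in>Poly_Mapping.keys f. \<forall>s\<in>Poly_Mapping.keys f. (s, t) \<in> ord"
    using \<open>f \<noteq> 0\<close> by simp
  then show ?thesis using lin(3) by (metis antisymD)
qed

lemma ideal_gen_monoms_keys:
  fixes p :: "('n, 'k::field) R"
  assumes "p \<in> ideal_gen (monom ` S)" and "t \<in> Poly_Mapping.keys p"
  shows "\<exists>s\<in>S. \<exists>u. t = s + u"
proof -
  interpret M: module "(*) :: ('n, 'k) R \<Rightarrow> _" by (rule module_self)
  have "\<forall>t\<in>Poly_Mapping.keys p. \<exists>s\<in>S. \<exists>u. t = s + u"
    using assms(1)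
  proof (induction rule: M.span_induct_alt)
    case base
    then show ?case by simp
  next
    case (step c x y)
    then obtain s where s: "s \<in> S" "x = monom s" by auto
    have "\<exists>s\<in>S. \<exists>u. t = s + u" if t: "t \<in> Poly_Mapping.keys (c * x)" for t
    proof -
      obtain a b where "t = a + b" "b \<in> Poly_Mapping.keys x"
        using keys_mult t by blast
      then have "t = s + a" using s by (simp add: add.commute)
      then show ?thesis using s(1) by blast
    qed
    then show ?case using step keys_add[of "c * x" y] by blast
  qed
  then show ?thesis using assms(2) by blast
qed

lemma monom_in_ideal_gen:
  assumes "s \<in> S"
  shows "(monom (s + u) :: ('n, 'k::field) R) \<in> ideal_gen (monom ` S)"
proof -
  interpret M: module "(*) :: ('n, 'k) R \<Rightarrow> _" by (rule module_self)
  have "monom u * monom s \<in> M.span (monom ` S)"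
    using assms by (intro M.span_scale M.span_base) auto
  then show ?thesis by (simp add: mult_single add.commute)
qed

lemma minimal_monomial_gens_unique:
  fixes L :: "('n, 'k::field) R set"
  assumes "minimal_monomial_gens L G" "minimal_monomial_gens L H"
  shows "G \<subseteq> H"
proof
  interpret M: module "(*) :: ('n, 'k) R \<Rightarrow> _" by (rule module_self)
  fix g assume g: "g \<in> G"
  obtain A where A: "G = monom ` A" using assms(1)
    by (auto simp: minimal_monomial_gens_def subset_image_iff)
  obtain B where B: "H = monom ` B" using assms(2)
    by (auto simp: minimal_monomial_gens_def subset_image_iff)
  have gen: "ideal_gen G = L" "ideal_gen H = L" 
    and min: "\<And>H. H \<subset> G \<Longrightarrow> ideal_gen H \<noteq> L"
    using assms by (auto simp: minimal_monomial_gens_def)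
  obtain s where s: "s \<in> A" "g = monom s" using A g by auto
  have "g \<in> L" using g gen(1) M.span_base by metis
  then obtain t u where t: "t \<in> B" "s = t + u"
    using ideal_gen_monoms_keys[of g B s] B gen s by auto
  have "monom t \<in> H" using t(1) B by simp
  then have "monom t \<in> L" using gen(2) M.span_base by metis
  then obtain s' u' where s': "s' \<in> A" "t = s' + u'"
    using ideal_gen_monoms_keys[of "monom t" A t] A gen by auto
  have "s' = s"
  proof (rule ccontr)
    assume ne: "s' \<noteq> s"
    let ?G = "monom ` (A - {s}) :: ('n, 'k) R set"
    have "monom (s' + (u' + u)) \<in> ideal_gen ?G"
      using ne s'(1) by (intro monom_in_ideal_gen) auto
    then have "g \<in> ideal_gen ?G" using s t s' by (simp add: add.assoc)
    moreover have "h \<in> ideal_gen ?G" if "h \<in> G" "h \<noteq> g" for h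
      using that A s by (intro M.span_base) auto
    ultimately have "G \<subseteq> ideal_gen ?G" by auto
    then have "L \<subseteq> ideal_gen ?G" unfolding gen(1)[symmetric]
      by (intro M.span_minimal M.subspace_span)
    moreover have "ideal_gen ?G \<subseteq> L" unfolding gen(1)[symmetric] A by (intro M.span_mono) auto
    ultimately have "ideal_gen ?G = L" by blast
    moreover have "g \<notin> ?G" using s by (auto dest!: arg_cong[where f = Poly_Mapping.keys])
    then have "?G \<subset> G" using A g by blast
    ultimately show False using min by blast
  qed
  then have "s = s + (u' + u)" using t s' by (simp add: add.assoc)
  then have "u' + u = 0" by simp
  then have "u = 0"
    by (intro poly_mapping_eqI) (metis add_is_0 lookup_add lookup_zero)
  then show "g \<in> H" using s t B by simp
qed

lemma minimal_monomial_gens_ex: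
  fixes S :: "'n expo set" and ord :: "'n expo rel"
  assumes ord: "monomial_ordering ord"
  shows "\<exists>G. minimal_monomial_gens (ideal_gen (monom ` S :: ('n, 'k::field) R set)) G"
proof -
  interpret M: module "(*) :: ('n, 'k) R \<Rightarrow> _" by (rule module_self)
  define A where "A = {s\<in>S. \<forall>s'\<in>S. \<forall>u. s = s' + u \<longrightarrow> s' = s}"
  let ?G = "monom ` A :: ('n, 'k) R set"
  have lin: "refl ord" "trans ord" "antisym ord" "total ord" and wf: "wf (ord - Id)"
    and add: "\<And>s t u. (s, t) \<in> ord \<Longrightarrow> (s + u, t + u) \<in> ord"
    using ord by (auto simp: monomial_ordering_def order_on_defs)
  have zero: "(0, u) \<in> ord" for u
  proof (rule ccontr)
    assume neg: "(0, u) \<notin> ord"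
    then have "(u, 0) \<in> ord" "u \<noteq> 0"
      using lin by (metis UNIV_I refl_onD total_on_def)+
    have "(((+) u ^^ Suc i) 0, ((+) u ^^ i) 0) \<in> ord - Id" for i
      using add[OF \<open>(u, 0) \<in> ord\<close>] \<open>u \<noteq> 0\<close> by simp
    then have "\<exists>f. \<forall>i. (f (Suc i), f i) \<in> ord - Id"
      by (intro exI[of _ "\<lambda>i. ((+) u ^^ i) 0"]) blast
    then show False using wf by (simp add: wf_iff_no_infinite_down_chain)
  qed
  have div: "\<exists>a\<in>A. \<exists>u. s = a + u" if "s \<in> S" for s
    using that
  proof (induction s rule: wf_induct_rule[OF wf])
    case (1 s)
    show ?case
    proof (cases "s \<in> A")
      case True
      then show ?thesis by (metis add.right_neutral)
    next
      case False
      then obtain s' u where s': "s' \<in> S" "s = s' + u" "s' \<noteq> s"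
        using 1(2) by (auto simp: A_def)
      have "(s', s) \<in> ord - Id" using add[OF zero, of s' u] s' by (simp add: add.commute)
      then obtain a u' where "a \<in> A" "s' = a + u'" using 1(1) s'(1) by blast
      then show ?thesis using s'(2) by (metis add.assoc)
    qed
  qed
  have "monom ` S \<subseteq> ideal_gen ?G"
  proof
    fix x :: "('n, 'k) R" assume "x \<in> monom ` S"
    then obtain s where "s \<in> S" "x = monom s" by auto
    then show "x \<in> ideal_gen ?G" using div monom_in_ideal_gen by metis
  qed
  then have "ideal_gen (monom ` S) \<subseteq> ideal_gen ?G"
    by (intro M.span_minimal M.subspace_span)
  moreover have "ideal_gen ?G \<subseteq> ideal_gen (monom ` S)"
    by (intro M.span_mono) (auto simp: A_def)
  ultimately have eq: "ideal_gen ?G = ideal_gen (monom ` S)" by blast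
  have "ideal_gen H \<noteq> ideal_gen (monom ` S)" if H: "H \<subset> ?G" for H
  proof
    assume *: "ideal_gen H = ideal_gen (monom ` S)"
    obtain B where B: "H = monom ` B" "B \<subseteq> A" using H by (meson psubset_imp_subset subset_image_iff)
    then obtain a where a: "a \<in> A" "a \<notin> B" using H by blast
    have "monom a \<in> ideal_gen H" unfolding * eq[symmetric] using a by (intro M.span_base) simp
    then obtain b u where b: "b \<in> B" "a = b + u"
      using ideal_gen_monoms_keys[of "monom a" B a] B by auto
    then have "b \<in> S" using B(2) by (auto simp: A_def)
    then have "b = a" using a(1) b(2) by (simp add: A_def)
    then show False using a(2) b(1) by simp
  qed
  then have "minimal_monomial_gens (ideal_gen (monom ` S)) ?G"
    using eq by (auto simp: minimal_monomial_gens_def)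
  then show ?thesis by blast
qed

lemma Lt_ideal_monoms:
  fixes I :: "('n, 'k::field) R set"
  assumes "monomial_ordering ord"
  shows "Lt_ideal ord I = ideal_gen (monom ` {lead_expo ord f | f. f \<in> I \<and> f \<noteq> 0})"
    (is "_ = ideal_gen ?S")
proof -
  interpret M: module "(*) :: ('n, 'k) R \<Rightarrow> _" by (rule module_self)
  let ?T = "{Lt ord f | f. f \<in> I \<and> f \<noteq> 0}"
  have Lt: "Lt ord f = Poly_Mapping.single 0 (Poly_Mapping.lookup f (lead_expo ord f)) * monom (lead_expo ord f)"
    for f :: "('n, 'k) R"
    by (simp add: Lt_def mult_single)
  have nz: "Poly_Mapping.lookup f (lead_expo ord f) \<noteq> 0" if "f \<noteq> 0" for f :: "('n, 'k) R"
    using theI'[OF lead_expo_ex1[OF assms that]] by (simp add: lead_expo_def in_keys_iff)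
  have inv: "monom (lead_expo ord f) =
      Poly_Mapping.single 0 (inverse (Poly_Mapping.lookup f (lead_expo ord f))) * Lt ord f"
    if "f \<noteq> 0" for f :: "('n, 'k) R"
    using nz[OF that] by (simp add: Lt_def mult_single)
  have "?T \<subseteq> ideal_gen ?S"
  proof
    fix x assume "x \<in> ?T"
    then obtain f where f: "f \<in> I" "f \<noteq> 0" "x = Lt ord f" by blast
    have "monom (lead_expo ord f) \<in> ?S" using f by blast
    then show "x \<in> ideal_gen ?S" unfolding f(3) Lt by (intro M.span_scale M.span_base)
  qed
  moreover have "?S \<subseteq> ideal_gen ?T"
  proof
    fix x assume "x \<in> ?S"
    then obtain f where f: "f \<in> I" "f \<noteq> 0" "x = monom (lead_expo ord f)" by blast
    have "Lt ord f \<in> ?T" using f by blast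
    then show "x \<in> ideal_gen ?T" unfolding f(3) inv[OF f(2)] by (intro M.span_scale M.span_base)
  qed
  ultimately have "ideal_gen ?T = ideal_gen ?S"
    by (intro subset_antisym M.span_minimal M.subspace_span)
  then show ?thesis by (simp add: Lt_ideal_def)
qed

lemma min_gens_ex1:
  fixes I :: "('n, 'k::field) R set"
  assumes "monomial_ordering ord"
  shows "\<exists>!G. minimal_monomial_gens (Lt_ideal ord I) G"
proof -
  obtain G where "minimal_monomial_gens (Lt_ideal ord I) G"
    using minimal_monomial_gens_ex[OF assms] unfolding Lt_ideal_monoms[OF assms] by blast
  then show ?thesis using minimal_monomial_gens_unique by blast
qed

end

theory Submission
  imports Defs
begin

text \<open>
  Only \<open>I \<inter> J \<subseteq> IJ\<close> has content, and it is division with remainder. Let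
  \<open>h \<in> I \<inter> J\<close> be nonzero. Its leading monomial lies in both leading ideals, so it is
  divisible by the leading monomial of some \<open>f \<in> I\<close>, which uses only variables of
  \<open>m(I)\<close>, and by that of some \<open>g \<in> J\<close>, which uses only variables of
  \<open>m(J)\<close> (lemma \<open>lead_expo_divisor_in_supp\<close>). These two monomials have no variable in
  common, hence their product, the leading monomial of \<open>f g\<close>, divides that of
  \<open>h\<close> as well. Subtracting a monomial multiple of \<open>f g \<in> IJ\<close> therefore cancels the
  leading term of \<open>h\<close> (lemma \<open>cancel_leading_term\<close>), and the remainder is again in
  \<open>I \<inter> J\<close>. As the ordering is a well-order, the process ends, at the
  remainder \<open>0\<close>.
\<close>

definition keys_below :: "'n expo rel \<Rightarrow> 'n expo \<Rightarrow> ('n, 'k::field) R \<Rightarrow> bool" where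
  "keys_below ord t p \<longleftrightarrow> (\<forall>s\<in>Poly_Mapping.keys p. (s, t) \<in> ord - Id)"

lemma keys_below_add:
  "keys_below ord t p \<Longrightarrow> keys_below ord t q \<Longrightarrow> keys_below ord t (p + q)"
  using keys_add[of p q] by (fastforce simp: keys_below_def)

lemma keys_below_diff:
  "keys_below ord t p \<Longrightarrow> keys_below ord t q \<Longrightarrow> keys_below ord t (p - q)"
  using keys_diff[of p q] by (fastforce simp: keys_below_def)

lemma monomial_ordering_add_strict_mono:
  assumes ord: "monomial_ordering ord" and "(s, a) \<in> ord - Id" and "(t, b) \<in> ord"
  shows "(s + t, a + b) \<in> ord - Id"
proof -
  have add: "\<And>s t u. (s, t) \<in> ord \<Longrightarrow> (s + u, t + u) \<in> ord"
    and "trans ord" "antisym ord"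
    using ord by (auto simp: monomial_ordering_def order_on_defs)
  have 1: "(s + t, a + t) \<in> ord" "s + t \<noteq> a + t" using assms add by auto
  have 2: "(a + t, a + b) \<in> ord" using add[OF assms(3), of a] by (simp add: add.commute)
  have "(s + t, a + b) \<in> ord" using 1 2 \<open>trans ord\<close> by (meson transD)
  moreover have "s + t \<noteq> a + b" using 1 2 \<open>antisym ord\<close> by (metis antisymD)
  ultimately show ?thesis by simp
qed

lemma keys_below_mult:
  assumes "monomial_ordering ord" and "keys_below ord a p"
    and "\<And>s. s \<in> Poly_Mapping.keys q \<Longrightarrow> (s, b) \<in> ord"
  shows "keys_below ord (a + b) (p * q)"
  unfolding keys_below_def
proof
  fix r assume "r \<in> Poly_Mapping.keys (p * q)"
  then obtain s t where "r = s + t" "s \<in> Poly_Mapping.keys p" "t \<in> Poly_Mapping.keys q"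
    using keys_mult by blast
  then show "(r, a + b) \<in> ord - Id"
    using assms monomial_ordering_add_strict_mono by (metis keys_below_def)
qed

lemma lead_expo_max:
  fixes f :: "('n, 'k::field) R"
  assumes "monomial_ordering ord" and "f \<noteq> 0"
  shows "lead_expo ord f \<in> Poly_Mapping.keys f"
    and "s \<in> Poly_Mapping.keys f \<Longrightarrow> (s, lead_expo ord f) \<in> ord"
  using theI'[OF lead_expo_ex1[OF assms]] by (auto simp: lead_expo_def)

lemma keys_below_tail:
  fixes f :: "('n, 'k::field) R"
  assumes "monomial_ordering ord" and "f \<noteq> 0"
  shows "keys_below ord (lead_expo ord f) (f - Lt ord f)"
  using lead_expo_max(2)[OF assms]
  by (auto simp: keys_below_def Lt_def in_keys_iff lookup_minus lookup_single when_def
        split: if_splits)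

text \<open>
  Writing each factor as leading term plus tail, the coefficient below is the one for which the
  product of the leading terms is \<open>Lt(h)\<close>; every other summand has its exponents
  strictly below that of \<open>Lt(h)\<close>.
\<close>

lemma cancel_leading_term:
  fixes f g h :: "('n, 'k::field) R"
  assumes ord: "monomial_ordering ord" and nz: "f \<noteq> 0" "g \<noteq> 0" "h \<noteq> 0"
    and t: "lead_expo ord h = u + lead_expo ord f + lead_expo ord g"
  shows "\<exists>c. keys_below ord (lead_expo ord h) (h - Poly_Mapping.single u c * f * g)"
proof -
  define lc :: "('n, 'k) R \<Rightarrow> 'k" where "lc = (\<lambda>p. Poly_Mapping.lookup p (lead_expo ord p))"
  define c where "c = lc h / (lc f * lc g)"
  let ?M = "Poly_Mapping.single u c"
  let ?f = "f - Lt ord f" and ?g = "g - Lt ord g" and ?h = "h - Lt ord h"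
  have refl: "refl ord" using ord by (auto simp: monomial_ordering_def order_on_defs)
  have lc: "lc p \<noteq> 0" if "p \<noteq> 0" for p
    using lead_expo_max(1)[OF ord that] by (simp add: lc_def in_keys_iff)
  have Lt: "Lt ord p = Poly_Mapping.single (lead_expo ord p) (lc p)" for p
    by (simp add: Lt_def lc_def)
  have "?M * Lt ord f * Lt ord g = Lt ord h"
    using lc nz by (simp add: Lt mult_single t c_def)
  then have split: "h - ?M * f * g = ?h - (?f * g * ?M + ?g * (Lt ord f * ?M))"
    by (simp add: algebra_simps)
  have "keys_below ord (lead_expo ord f + lead_expo ord g + u) (?f * g * ?M)"
    using refl by (intro keys_below_mult ord keys_below_tail nz lead_expo_max(2))
      (auto simp: refl_onD split: if_splits)
  then have 1: "keys_below ord (lead_expo ord h) (?f * g * ?M)"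
    by (simp add: t ac_simps)
  have "keys_below ord (lead_expo ord g + (lead_expo ord f + u)) (?g * (Lt ord f * ?M))"
    using refl by (intro keys_below_mult ord keys_below_tail nz)
      (auto simp: Lt_def mult_single add.commute refl_onD split: if_splits)
  then have 2: "keys_below ord (lead_expo ord h) (?g * (Lt ord f * ?M))"
    by (simp add: t ac_simps)
  have "keys_below ord (lead_expo ord h) (h - ?M * f * g)"
    unfolding split by (intro keys_below_diff keys_below_add keys_below_tail ord nz 1 2)
  then show ?thesis ..
qed

lemma disjoint_keys_divisors_add:
  fixes a b :: "'v \<Rightarrow>\<^sub>0 nat"
  assumes "t = a + p" and "t = b + q" and "Poly_Mapping.keys a \<inter> Poly_Mapping.keys b = {}"
  shows "\<exists>u. t = u + a + b"
proof
  show "t = (t - a - b) + a + b"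
  proof (rule poly_mapping_eqI)
    fix v
    have "Poly_Mapping.lookup a v = 0 \<or> Poly_Mapping.lookup b v = 0"
      using assms(3) by (auto simp: in_keys_iff)
    moreover have "Poly_Mapping.lookup t v \<ge> Poly_Mapping.lookup a v"
      using assms(1) by (simp add: lookup_add)
    moreover have "Poly_Mapping.lookup t v \<ge> Poly_Mapping.lookup b v"
      using assms(2) by (simp add: lookup_add)
    ultimately show "Poly_Mapping.lookup t v = Poly_Mapping.lookup (t - a - b + a + b) v"
      by (auto simp: lookup_add lookup_minus)
  qed
qed

lemma indet_dvd_monom:
  assumes "v \<in> Poly_Mapping.keys s"
  shows "(indet v :: ('n, 'k::field) R) dvd monom s"
proof -
  have "s = Poly_Mapping.single v 1 + (s - Poly_Mapping.single v 1)"
    using assms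
    by (intro poly_mapping_eqI) (auto simp: lookup_add lookup_minus lookup_single when_def in_keys_iff)
  then have "(monom s :: ('n, 'k) R) = indet v * monom (s - Poly_Mapping.single v 1)"
    by (metis mult_1 mult_single)
  then show ?thesis by (rule dvdI)
qed

lemma keys_subset_supp:
  assumes "(monom s :: ('n, 'k::field) R) \<in> T"
  shows "Poly_Mapping.keys s \<subseteq> supp T"
proof
  fix v assume "v \<in> Poly_Mapping.keys s"
  then have "\<exists>m\<in>T. indet v dvd m" using assms indet_dvd_monom by blast
  then show "v \<in> supp T" by (cases v) (auto simp: supp_def)
qed

text \<open>
  The leading monomial of \<open>h\<close> is a multiple of a minimal generator, and that generator,
  being in the leading ideal, is a multiple of the leading monomial of some
  \<open>f \<in> I\<close>. Hence the latter involves no variable outside the generator.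
\<close>

lemma lead_expo_divisor_in_supp:
  fixes I :: "('n, 'k::field) R set"
  assumes ord: "monomial_ordering ord" and h: "h \<in> I" "h \<noteq> 0"
  obtains f w where "f \<in> I" "f \<noteq> 0" "lead_expo ord h = lead_expo ord f + w"
    "Poly_Mapping.keys (lead_expo ord f) \<subseteq> supp (min_gens ord I)"
proof -
  interpret M: module "(*) :: ('n, 'k) R \<Rightarrow> _" by (rule module_self)
  let ?S = "{lead_expo ord f | f. f \<in> I \<and> f \<noteq> 0}"
  have "minimal_monomial_gens (Lt_ideal ord I) (min_gens ord I)"
    unfolding min_gens_def by (rule theI'[OF min_gens_ex1[OF ord]])
  then obtain A where A: "min_gens ord I = monom ` A"
    and gen: "ideal_gen (monom ` A) = ideal_gen (monom ` ?S :: ('n, 'k) R set)"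
    unfolding minimal_monomial_gens_def Lt_ideal_monoms[OF ord]
    by (metis subset_image_iff)
  have "(monom (lead_expo ord h) :: ('n, 'k) R) \<in> ideal_gen (monom ` A)"
    unfolding gen using h by (intro M.span_base) blast
  then obtain s w where s: "s \<in> A" "lead_expo ord h = s + w"
    using ideal_gen_monoms_keys[of _ A "lead_expo ord h"] by fastforce
  have "(monom s :: ('n, 'k) R) \<in> ideal_gen (monom ` ?S)"
    unfolding gen[symmetric] using s by (intro M.span_base) blast
  then obtain f w' where f: "f \<in> I" "f \<noteq> 0" "s = lead_expo ord f + w'"
    using ideal_gen_monoms_keys[of _ ?S s] by fastforce
  have "Poly_Mapping.keys (lead_expo ord f) \<subseteq> Poly_Mapping.keys s"
    unfolding f(3) by (auto simp: in_keys_iff lookup_add)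
  also have "\<dots> \<subseteq> supp (min_gens ord I)" using s(1) A by (intro keys_subset_supp) simp
  finally show thesis using that[of f "w' + w"] f s(2) by (simp add: add.assoc)
qed

lemma ideal_mult_subset_Int:
  fixes I J :: "'a::comm_ring_1 set"
  assumes "is_ideal I" and "is_ideal J"
  shows "ideal_mult I J \<subseteq> I \<inter> J"
proof -
  interpret M: module "(*) :: 'a \<Rightarrow> _" by (rule module_self)
  have "a * b \<in> I \<inter> J" if "a \<in> I" "b \<in> J" for a b
    using M.subspace_scale[OF assms(1) that(1), of b] M.subspace_scale[OF assms(2) that(2), of a]
    by (simp add: mult.commute)
  then show ?thesis
    unfolding ideal_mult_def using assms by (intro M.span_minimal M.subspace_inter) auto
qed

lemma Int_subset_ideal_mult:
  fixes I J :: "('n, 'k::field) R set"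
  assumes ord: "monomial_ordering ord" and I: "is_ideal I" and J: "is_ideal J"
    and disj: "supp (min_gens ord I) \<inter> supp (min_gens ord J) = {}"
  shows "I \<inter> J \<subseteq> ideal_mult I J"
proof
  interpret M: module "(*) :: ('n, 'k) R \<Rightarrow> _" by (rule module_self)
  have wf: "wf (inv_image (ord - Id) (lead_expo ord :: ('n, 'k) R \<Rightarrow> _))"
    using ord by (auto simp: monomial_ordering_def well_order_on_def)
  fix h assume "h \<in> I \<inter> J"
  then show "h \<in> ideal_mult I J"
  proof (induction h rule: wf_induct_rule[OF wf])
    case (1 h)
    show ?case
    proof (cases "h = 0")
      case True
      then show ?thesis by (simp add: ideal_mult_def M.span_zero)
    next
      case False
      obtain f p where f: "f \<in> I" "f \<noteq> 0" "lead_expo ord h = lead_expo ord f + p"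
        "Poly_Mapping.keys (lead_expo ord f) \<subseteq> supp (min_gens ord I)"
        using lead_expo_divisor_in_supp[OF ord _ False, of I] 1(2) by blast
      obtain g q where g: "g \<in> J" "g \<noteq> 0" "lead_expo ord h = lead_expo ord g + q"
        "Poly_Mapping.keys (lead_expo ord g) \<subseteq> supp (min_gens ord J)"
        using lead_expo_divisor_in_supp[OF ord _ False, of J] 1(2) by blast
      obtain u where "lead_expo ord h = u + lead_expo ord f + lead_expo ord g"
        using disjoint_keys_divisors_add[OF f(3) g(3)] f(4) g(4) disj by blast
      then obtain c where
        below: "keys_below ord (lead_expo ord h) (h - Poly_Mapping.single u c * f * g)"
        using cancel_leading_term[OF ord f(2) g(2) False] by blast
      define P where "P = Poly_Mapping.single u c * f * g"
      have P: "P \<in> ideal_mult I J"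
        unfolding ideal_mult_def P_def
        using g(1) M.subspace_scale[OF I f(1), of "Poly_Mapping.single u c"]
        by (intro M.span_base) blast
      then have "P \<in> I \<inter> J" using ideal_mult_subset_Int[OF I J] by blast
      then have mem: "h - P \<in> I \<inter> J" using 1(2) M.subspace_diff I J by blast
      have "h - P \<in> ideal_mult I J"
      proof (cases "h - P = 0")
        case True
        then show ?thesis by (simp add: ideal_mult_def M.span_zero)
      next
        case False
        then have "(lead_expo ord (h - P), lead_expo ord h) \<in> ord - Id"
          using below lead_expo_max(1)[OF ord] unfolding keys_below_def P_def by blast
        then show ?thesis using 1(1) mem by simp
      qed
      then have "h - P + P \<in> ideal_mult I J"
        using P unfolding ideal_mult_def by (rule M.span_add)
      then show ?thesis by simp
    qed
  qed
qed

theorem lemma2p1: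
  fixes ord :: "'n::finite expo rel"
    and I J :: "('n, 'k::field) R set"
  assumes "CARD('n) \<ge> 2"
    and "monomial_ordering ord"
    and "is_ideal I" and "is_ideal J"
    and "supp (min_gens ord I) \<inter> supp (min_gens ord J) = {}"
  shows "I \<inter> J = ideal_mult I J"
  using Int_subset_ideal_mult[OF assms(2-5)] ideal_mult_subset_Int[OF assms(3,4)]
  by (rule subset_antisym)

end
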